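(* Let $q$ be a power of a prime, let $m$ be a positive integer and let $N \mid q-1$ be such that $N$ is coprime to $(q^m-1)/(q-1)$. Then the number of $N$-free elements $\xi \in \mathbb{F}_{q^m}$ with $\operatorname{Tr}_{\mathbb{F}_{q^m}/\mathbb{F}_q}(\xi) = 0$ is $$\frac{\phi(N)}{N}\left(q^{m-1}-1\right).$$
   Context: $\phi$ is Euler's function and divisors are positive. For a positive divisor $N$ of $q^m-1$, a non-zero element $\xi \in \mathbb{F}_{q^m}^*$ is called $N$-free if, for any $d \mid N$, $\xi = \gamma^d$ with $\gamma \in \mathbb{F}_{q^m}$ implies $d=1$; equivalently $\xi = \alpha^k$ for some integer $k$ coprime to $N$, where $\alpha$ is a primitive element of $\mathbb{F}_{q^m}$ (the notion does not depend on the choice of $\alpha$). $N$-free elements are non-zero by definition. *)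

theory Defs
  imports "HOL-Number_Theory.Number_Theory" "HOL-Library.Cardinality"
begin

text \<open>
  The field with \<open>q ^ m\<close> elements is rendered as a type of class \<open>finite_field\<close> with
  \<open>CARD('a) = q ^ m\<close>; its subfield with \<open>q\<close> elements is \<open>{x. x ^ q = x}\<close>.
\<close>

definition N_free :: "nat \<Rightarrow> 'a::finite_field \<Rightarrow> bool" where
  "N_free N \<xi> \<longleftrightarrow> \<xi> \<noteq> 0 \<and> (\<forall>d. d dvd N \<longrightarrow> (\<exists>\<gamma>. \<xi> = \<gamma> ^ d) \<longrightarrow> d = 1)"

text \<open>
  The trace of the extension of degree \<open>m\<close> over the field with \<open>q\<close> elements is the sum of the
  conjugates of \<open>\<xi>\<close>, that is of its images under the \<open>m\<close> powers of the Frobenius map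
  \<open>x \<mapsto> x ^ q\<close>, which generates the Galois group.  Its values lie in the subfield
  \<open>{x. x ^ q = x}\<close> but are kept in the large field.
\<close>

definition field_trace :: "nat \<Rightarrow> nat \<Rightarrow> 'a::finite_field \<Rightarrow> 'a" where
  "field_trace q m \<xi> = (\<Sum>i<m. \<xi> ^ (q ^ i))"

end

theory Submission
  imports Defs "HOL-Algebra.Algebraic_Closure_Type"
begin

text \<open>
  Let \<open>g\<close> generate the multiplicative group of the field with \<open>q ^ m\<close> elements, which is cyclic
  of order \<open>q ^ m - 1\<close>.  The element \<open>g ^ i\<close> is \<open>N\<close>-free exactly when \<open>i\<close> is coprime to \<open>N\<close>
  (\<open>N_free_power_iff_coprime\<close>), so freeness only depends on the discrete logarithm modulo \<open>N\<close>.

  Put \<open>M = (q ^ m - 1) / (q - 1)\<close>.  The power \<open>g ^ M\<close> lies in the subfield with \<open>q\<close> elements, and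
  the trace is linear over that subfield, so multiplication by \<open>g ^ M\<close> permutes the non-zero
  elements of trace zero.  On logarithms it is the shift by \<open>M\<close>.  As \<open>M\<close> is invertible
  modulo \<open>N\<close>, iterating the shift carries any residue class modulo \<open>N\<close> to any other one.  Hence
  the logarithms of the non-zero elements of trace zero are equidistributed over the \<open>N\<close> residue
  classes, and the \<open>N\<close>-free ones make up the fraction \<open>totient N / N\<close>
  (\<open>card_N_free_invariant\<close>).

  It remains to count the kernel of the trace (\<open>card_kernel_trace\<close>).  The trace is a polynomial
  function of degree \<open>q ^ (m - 1)\<close>, which bounds the kernel from above.  It is additive with
  values among the at most \<open>q\<close> roots of \<open>y ^ q = y\<close>, and all its non-empty fibres have the size of
  the kernel, which gives the same bound from below.
\<close>

section \<open>Discrete logarithms in a finite field\<close>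

definition primitive_root :: "'a::finite_field \<Rightarrow> bool" where
  "primitive_root g \<longleftrightarrow> bij_betw (\<lambda>i. g ^ i) {..<CARD('a) - 1} (UNIV - {0})"

lemma power_card_minus_one:
  fixes x :: "'a::finite_field"
  assumes "x \<noteq> 0"
  shows "x ^ (CARD('a) - 1) = 1"
proof -
  have "x * x ^ (CARD('a) - 1) = x ^ CARD('a)"
    by (metis finite_UNIV_card_ge_0 finite power_Suc Suc_diff_1)
  also have "\<dots> = x * 1"
    by (simp add: finite_field_power_card_eq_same)
  finally show ?thesis
    using assms by simp
qed

lemma card_finite_field_gt_one: "CARD('a::finite_field) > 1"
proof -
  have "card {0, 1 :: 'a} \<le> CARD('a)"
    by (intro card_mono) auto
  then show ?thesis by simp
qed

lemma power_mod_card: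
  fixes g :: "'a::finite_field"
  assumes "g \<noteq> 0"
  shows "g ^ (i mod (CARD('a) - 1)) = g ^ i"
proof -
  have "g ^ i = g ^ ((CARD('a) - 1) * (i div (CARD('a) - 1)) + i mod (CARD('a) - 1))"
    by simp
  then show ?thesis
    unfolding power_add power_mult power_card_minus_one[OF assms] by simp
qed

text \<open>
  The multiplicative group of a finite ring record that is a field is cyclic; this carries over
  to the type class by viewing the type as a ring record.  The powers of a generator exhaust the
  \<open>CARD('a) - 1\<close> non-zero elements and the exponents below \<open>CARD('a) - 1\<close> already give all of
  them, so on these exponents the power map is a bijection.
\<close>
lemma primitive_root_exists: "\<exists>g :: 'a::finite_field. g \<noteq> 0 \<and> primitive_root g"
proof -
  define R :: "'a ring" where "R = ring_of_type_algebra"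
  interpret R: field R
    unfolding R_def by rule
  have R_simps: "carrier R = UNIV" "\<zero>\<^bsub>R\<^esub> = 0" "\<one>\<^bsub>R\<^esub> = 1" "x \<otimes>\<^bsub>R\<^esub> y = x * y" for x y
    by (simp_all add: R_def ring_of_type_algebra_def)
  have pow: "a [^]\<^bsub>R\<^esub> (i::nat) = a ^ i" for a i
    by (induction i) (simp_all add: R_simps mult.commute)
  have "\<exists>a\<in>UNIV - {0 :: 'a}. UNIV - {0} = {a ^ i | i::nat. i \<in> UNIV}"
    using R.finite_field_mult_group_has_gen by (simp add: R_simps pow)
  then obtain g :: 'a where "g \<in> UNIV - {0}"
    and powers: "UNIV - {0} = {g ^ i | i::nat. i \<in> UNIV}" ..
  then have g: "g \<noteq> 0" by blast
  let ?n = "CARD('a) - 1"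
  have "range (\<lambda>i::nat. g ^ i) = (\<lambda>i. g ^ i) ` {..<?n}"
  proof
    show "range (\<lambda>i::nat. g ^ i) \<subseteq> (\<lambda>i. g ^ i) ` {..<?n}"
    proof
      fix x assume "x \<in> range (\<lambda>i::nat. g ^ i)"
      then obtain i where "x = g ^ i" by blast
      then have "x = g ^ (i mod ?n)"
        by (simp only: power_mod_card[OF g])
      moreover have "i mod ?n < ?n"
        using card_finite_field_gt_one[where ?'a = 'a] by (intro mod_less_divisor) simp
      ultimately show "x \<in> (\<lambda>i. g ^ i) ` {..<?n}" by blast
    qed
  qed auto
  then have image: "(\<lambda>i. g ^ i) ` {..<?n} = UNIV - {0}"
    using powers by (simp add: full_SetCompr_eq)
  then have "card ((\<lambda>i. g ^ i) ` {..<?n}) = card {..<?n}"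
    by (simp add: card_Diff_singleton)
  then have "inj_on (\<lambda>i. g ^ i) {..<?n}"
    by (simp add: eq_card_imp_inj_on)
  then show ?thesis
    using image g unfolding primitive_root_def bij_betw_def by blast
qed

lemma primitive_root_power_eq_iff:
  fixes g :: "'a::finite_field"
  assumes "g \<noteq> 0" "primitive_root g"
  shows "g ^ i = g ^ j \<longleftrightarrow> [i = j] (mod (CARD('a) - 1))"
proof -
  let ?n = "CARD('a) - 1"
  have n: "?n > 0"
    using card_finite_field_gt_one[where ?'a = 'a] by simp
  have "g ^ i = g ^ j \<longleftrightarrow> g ^ (i mod ?n) = g ^ (j mod ?n)"
    by (simp only: power_mod_card[OF assms(1)])
  also have "\<dots> \<longleftrightarrow> i mod ?n = j mod ?n"
    using assms(2) n unfolding primitive_root_def bij_betw_def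
    by (intro inj_on_eq_iff[of "\<lambda>i. g ^ i" "{..<?n}"]) auto
  finally show ?thesis
    by (simp add: cong_def)
qed

lemma primitive_root_log:
  fixes g x :: "'a::finite_field"
  assumes "primitive_root g" "x \<noteq> 0"
  obtains i where "x = g ^ i"
  using assms unfolding primitive_root_def bij_betw_def by blast

text \<open>
  If \<open>d\<close> divides both \<open>i\<close> and \<open>N\<close>, then \<open>g ^ i\<close> is visibly a \<open>d\<close>-th power.  Conversely, a \<open>d\<close>-th
  power has logarithm \<open>j * d\<close> modulo the group order; since \<open>d\<close> divides \<open>N\<close>, hence the group
  order, \<open>d\<close> divides every logarithm of the element.
\<close>
lemma N_free_power_iff_coprime:
  fixes g :: "'a::finite_field"
  assumes g: "g \<noteq> 0" "primitive_root g" and N: "N dvd CARD('a) - 1"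
  shows "N_free N (g ^ i) \<longleftrightarrow> coprime i N"
proof
  assume free: "N_free N (g ^ i)"
  have "g ^ i = (g ^ (i div gcd i N)) ^ gcd i N"
    by (simp flip: power_mult)
  then have "gcd i N = 1"
    using free unfolding N_free_def by (meson gcd_dvd2)
  then show "coprime i N"
    unfolding coprime_iff_gcd_eq_1 .
next
  assume cop: "coprime i N"
  have N_pos: "N > 0"
    using N card_finite_field_gt_one[where ?'a = 'a] by (auto intro: Nat.gr0I)
  have "d = 1" if d: "d dvd N" and root: "g ^ i = \<gamma> ^ d" for d \<gamma>
  proof -
    have "d \<noteq> 0"
      using d N_pos by auto
    then have "\<gamma> \<noteq> 0"
      using root g(1) by (auto simp: power_0_left)
    then obtain j where "\<gamma> = g ^ j"
      using g(2) primitive_root_log by blast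
    then have "[i = j * d] (mod (CARD('a) - 1))"
      using root by (simp add: primitive_root_power_eq_iff[OF g] flip: power_mult)
    then have "[i = j * d] (mod d)"
      using d N by (meson cong_dvd_modulus_nat dvd_trans)
    then have "d dvd i"
      by (simp add: cong_dvd_iff)
    then show "d = 1"
      using d cop by (metis coprime_common_divisor_nat)
  qed
  then show "N_free N (g ^ i)"
    using g(1) by (auto simp: N_free_def)
qed

section \<open>Equidistribution of discrete logarithms on invariant sets\<close>

text \<open>
  Multiplication by a suitable power of \<open>g ^ M\<close> embeds any residue class of logarithms into any
  other one, because the multiples of \<open>M\<close> exhaust the residues modulo \<open>N\<close>.  By symmetry the
  two classes have the same size.
\<close>
lemma card_log_class_eq:
  fixes g :: "'a::finite_field"
  assumes g: "g \<noteq> 0" and cop: "coprime N M" and N: "N > 0"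
    and invariant: "\<And>x. x \<in> T \<Longrightarrow> g ^ M * x \<in> T"
  shows "card {x \<in> T. \<exists>i. x = g ^ i \<and> [i = r] (mod N)}
    = card {x \<in> T. \<exists>i. x = g ^ i \<and> [i = s] (mod N)}"
proof -
  let ?C = "\<lambda>r. {x \<in> T. \<exists>i. x = g ^ i \<and> [i = r] (mod N)}"
  have invariant_power: "g ^ (M * j) * x \<in> T" if "x \<in> T" for x j
    by (induction j) (use that invariant in \<open>auto simp: power_add mult.assoc\<close>)
  have le: "card (?C r) \<le> card (?C s)" for r s
  proof -
    \<comment> \<open>The shift from \<open>r\<close> to \<open>s\<close>; the multiple \<open>N * r\<close> keeps the subtraction non-negative.\<close>
    obtain t where t: "[r + t = s] (mod N)"
    proof
      have "r \<le> s + N * r" using N by (simp add: trans_le_add2)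
      then show "[r + (s + N * r - r) = s] (mod N)"
        by (simp add: cong_def)
    qed
    obtain u where "[M * u = 1] (mod N)"
      using cop by (metis One_nat_def coprime_commute cong_solve_coprime_nat)
    then have "[M * u * t = 1 * t] (mod N)"
      by (rule cong_scalar_right)
    then have "[r + M * (u * t) = r + t] (mod N)"
      by (intro cong_add) (simp_all add: mult.assoc)
    then have shift: "[r + M * (u * t) = s] (mod N)"
      using t cong_trans by blast
    let ?f = "\<lambda>x. g ^ (M * (u * t)) * x"
    have "?f ` ?C r \<subseteq> ?C s"
    proof
      fix y assume "y \<in> ?f ` ?C r"
      then obtain i where i: "g ^ i \<in> T" "[i = r] (mod N)" "y = g ^ (M * (u * t)) * g ^ i"
        by auto
      have "[i + M * (u * t) = s] (mod N)"
        using i(2) shift by (meson cong_add cong_refl cong_trans)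
      moreover have "y = g ^ (i + M * (u * t))"
        using i(3) by (simp add: power_add mult.commute)
      moreover have "y \<in> T"
        using invariant_power i(1,3) by blast
      ultimately show "y \<in> ?C s" by blast
    qed
    moreover have "inj_on ?f (?C r)"
      using g by (auto simp: inj_on_def)
    ultimately show ?thesis
      by (intro card_inj_on_le) auto
  qed
  show ?thesis
    using le[of r s] le[of s r] by simp
qed

text \<open>
  The elements \<open>c\<close> with \<open>c ^ h = 1\<close> form the subgroup of order \<open>h\<close>, generated by \<open>g ^ (n div h)\<close>
  for a primitive root \<open>g\<close> and \<open>n = CARD('a) - 1\<close>.  A set of non-zero elements that is stable under
  this subgroup meets all classes of logarithms modulo \<open>N\<close> equally often, and its free elements are those in the
  \<open>totient N\<close> classes of residues coprime to \<open>N\<close>.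
\<close>
lemma card_N_free_invariant:
  fixes T :: "'a::finite_field set"
  assumes h: "h dvd CARD('a) - 1" and N: "N dvd h"
    and cop: "coprime N ((CARD('a) - 1) div h)"
    and T: "0 \<notin> T"
    and invariant: "\<And>c x. c ^ h = 1 \<Longrightarrow> x \<in> T \<Longrightarrow> c * x \<in> T"
  shows "N * card {x \<in> T. N_free N x} = totient N * card T"
proof -
  obtain g :: 'a where g: "g \<noteq> 0" "primitive_root g"
    using primitive_root_exists by blast
  let ?n = "CARD('a) - 1"
  have Nn: "N dvd ?n"
    using N h by (rule dvd_trans)
  have N_pos: "N > 0"
    using Nn card_finite_field_gt_one[where ?'a = 'a] by (auto intro: Nat.gr0I)
  \<comment> \<open>Residues are represented in \<open>{0<..N}\<close>, the range that \<^const>\<open>totatives\<close> uses.\<close>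
  define C where "C = (\<lambda>r. {x \<in> T. \<exists>i. x = g ^ i \<and> [i = r] (mod N)})"
  have "(g ^ (?n div h)) ^ h = 1"
    using h power_card_minus_one[OF g(1)] by (simp flip: power_mult)
  then have card_C: "card (C r) = card (C 0)" for r
    unfolding C_def using invariant
    by (intro card_log_class_eq[OF g(1) cop N_pos]) blast
  have C_I: "x \<in> C r" if "x \<in> T" "x = g ^ i" "[i = r] (mod N)" for x i r
    unfolding C_def using that by (intro CollectI conjI exI)
  \<comment> \<open>Logarithms are unique modulo the group order, hence modulo its divisor \<open>N\<close>.\<close>
  have log_class: "[i = r] (mod N)" if "g ^ i \<in> C r" for i r
  proof -
    have "\<exists>j. g ^ i = g ^ j \<and> [j = r] (mod N)"
      using that by (simp add: C_def)
    then obtain j where j: "g ^ i = g ^ j" "[j = r] (mod N)"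
      by (elim exE conjE)
    then have "[i = j] (mod ?n)"
      by (simp only: primitive_root_power_eq_iff[OF g])
    then have "[i = j] (mod N)"
      using Nn by (rule cong_dvd_modulus_nat)
    then show ?thesis
      using j(2) by (rule cong_trans)
  qed
  have residue: "\<exists>r\<in>{0<..N}. [i = r] (mod N)" for i
  proof (cases "i mod N = 0")
    case True
    then have "[i = N] (mod N)" by (simp add: cong_def)
    then show ?thesis using N_pos by auto
  next
    case False
    then have "i mod N \<in> {0<..N}" "[i = i mod N] (mod N)"
      using N_pos by (auto simp: cong_def less_imp_le)
    then show ?thesis by blast
  qed
  have unique: "r = s" if "r \<in> {0<..N}" "s \<in> {0<..N}" "[r = s] (mod N)" for r s
  proof -
    have "[r - 1 + 1 = s - 1 + 1] (mod N)" using that by simp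
    then have "[r - 1 = s - 1] (mod N)" by (rule cong_add_rcancel_nat[THEN iffD1])
    then show ?thesis using that by (auto dest!: cong_less_modulus_unique_nat)
  qed
  have in_T: "\<exists>i. x = g ^ i" if "x \<in> T" for x
    using that T g(2) primitive_root_log by metis
  have card_Union: "card (\<Union>r\<in>I. C r) = card I * card (C 0)" if I: "I \<subseteq> {0<..N}" for I
  proof -
    have "card (\<Union>r\<in>I. C r) = (\<Sum>r\<in>I. card (C r))"
    proof (rule card_UN_disjoint)
      show "\<forall>r\<in>I. \<forall>s\<in>I. r \<noteq> s \<longrightarrow> C r \<inter> C s = {}"
      proof (intro ballI impI, rule ccontr)
        fix r s assume rs: "r \<in> I" "s \<in> I" "r \<noteq> s" "C r \<inter> C s \<noteq> {}"
        then obtain i where "g ^ i \<in> C r" "g ^ i \<in> C s"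
          using in_T by (fastforce simp: C_def)
        then have "[r = s] (mod N)"
          using log_class by (meson cong_sym cong_trans)
        then show False using rs I unique by blast
      qed
    qed (use I finite_subset in auto)
    also have "\<dots> = (\<Sum>r\<in>I. card (C 0))"
      by (intro sum.cong refl card_C)
    finally show ?thesis by simp
  qed
  have "T = (\<Union>r\<in>{0<..N}. C r)"
  proof
    show "T \<subseteq> (\<Union>r\<in>{0<..N}. C r)"
    proof
      fix x assume x: "x \<in> T"
      then obtain i where i: "x = g ^ i"
        using in_T[OF x] by (elim exE)
      obtain r where "r \<in> {0<..N}" "[i = r] (mod N)"
        using residue[of i] by blast
      with C_I[OF x i] show "x \<in> (\<Union>r\<in>{0<..N}. C r)"
        by (intro UN_I)
    qed
  qed (auto simp: C_def)
  then have card_T: "card T = N * card (C 0)"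
    using card_Union[of "{0<..N}"] by simp
  have "{x \<in> T. N_free N x} = (\<Union>r\<in>totatives N. C r)"
  proof (intro equalityI subsetI)
    fix x assume x: "x \<in> {x \<in> T. N_free N x}"
    then obtain i where i: "x = g ^ i"
      using in_T[of x] by auto
    then have "coprime i N"
      using x N_free_power_iff_coprime[OF g Nn] by simp
    moreover obtain r where r: "r \<in> {0<..N}" "[i = r] (mod N)"
      using residue by blast
    ultimately have "r \<in> totatives N"
      using cong_imp_coprime[OF r(2)] by (auto simp: totatives_def)
    moreover have "x \<in> C r"
      using x i r(2) by (intro C_I) auto
    ultimately show "x \<in> (\<Union>r\<in>totatives N. C r)"
      by (rule UN_I)
  next
    fix x assume "x \<in> (\<Union>r\<in>totatives N. C r)"
    then obtain r i where r: "coprime r N" "[i = r] (mod N)" "x = g ^ i" "x \<in> T"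
      by (auto simp: C_def totatives_def)
    then have "coprime i N"
      by (metis cong_imp_coprime cong_sym)
    then show "x \<in> {x \<in> T. N_free N x}"
      using r N_free_power_iff_coprime[OF g Nn] by simp
  qed
  then have "card {x \<in> T. N_free N x} = totient N * card (C 0)"
    using card_Union[of "totatives N"] by (simp add: totient_def totatives_def subset_iff)
  then show ?thesis
    by (simp add: card_T)
qed

section \<open>The kernel of the trace\<close>

lemma card_eq_power_imp_power_CHAR:
  assumes "primepow q" "m > 0" "CARD('a::finite_field) = q ^ m"
  obtains k where "q = CHAR('a) ^ k"
proof -
  \<comment> \<open>The plain name would denote prime elements of a monoid record.\<close>
  obtain p k where p: "normalization_semidom_class.prime p" "q = p ^ k"
    using assms(1) by (auto simp: primepow_def)
  have "CHAR('a) dvd p ^ (k * m)"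
    using CHAR_dvd_CARD[where ?'a = 'a] assms(3) p(2) by (simp add: power_mult)
  then have "CHAR('a) dvd p"
    using CHAR_prime prime_dvd_power by blast
  then have "CHAR('a) = p"
    using CHAR_prime p(1) primes_dvd_imp_eq by blast
  then show ?thesis
    using p(2) that by blast
qed

lemma field_trace_add:
  fixes x y :: "'a::finite_field"
  assumes "q = CHAR('a) ^ k"
  shows "field_trace q m (x + y) = field_trace q m x + field_trace q m y"
proof -
  have "(x + y) ^ (q ^ i) = x ^ (q ^ i) + y ^ (q ^ i)" for i
    by (rule freshmans_dream'[of _ "k * i"]) (simp_all add: assms power_mult)
  then show ?thesis
    by (simp add: field_trace_def sum.distrib)
qed

text \<open>
  Raising to the power \<open>q\<close> permutes the conjugates cyclically: the last one, \<open>x ^ (q ^ m)\<close>, is \<open>x\<close>.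
\<close>
lemma field_trace_power:
  fixes x :: "'a::finite_field"
  assumes "q = CHAR('a) ^ k" "CARD('a) = q ^ m" 
  shows "field_trace q m x ^ q = field_trace q m x"
proof -
  have "field_trace q m x ^ q = (\<Sum>i<m. (x ^ (q ^ i)) ^ q)"
    unfolding field_trace_def by (rule freshmans_dream_sum'[of _ k]) (simp_all add: assms(1))
  also have "\<dots> = (\<Sum>i<m. x ^ (q ^ Suc i))"
    by (simp add: mult.commute flip: power_mult)
  also have "\<dots> = field_trace q m x"
    using sum.lessThan_Suc_shift[of "\<lambda>i. x ^ (q ^ i)" m]
    by (simp add: field_trace_def flip: assms(2)) (simp add: finite_field_power_card_eq_same)
  finally show ?thesis .
qed

lemma card_power_fixed_le:
  assumes "q > 1"
  shows "card {y :: 'a::finite_field. y ^ q = y} \<le> q"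
proof -
  define P :: "'a poly" where "P = monom 1 q - monom 1 1"
  have "coeff P q = 1"
    using assms by (simp add: P_def)
  then have "P \<noteq> 0" by auto
  then have "card {y. poly P y = 0} \<le> degree P"
    by (rule card_poly_roots_bound)
  also have "degree P \<le> q"
    unfolding P_def using assms by (intro degree_diff_le) (auto simp: degree_monom_le degree_monom_eq)
  also have "{y. poly P y = 0} = {y. y ^ q = y}"
    by (simp add: P_def poly_monom)
  finally show ?thesis .
qed

lemma card_kernel_trace_le:
  assumes "q > 1" "m > 0"
  shows "card {x :: 'a::finite_field. field_trace q m x = 0} \<le> q ^ (m - 1)"
proof -
  define P :: "'a poly" where "P = (\<Sum>i<m. monom 1 (q ^ i))"
  have "coeff P (q ^ (m - 1)) = (\<Sum>i<m. if i = m - 1 then 1 else 0)"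
    using assms by (simp add: P_def coeff_sum power_inject_exp)
  then have "coeff P (q ^ (m - 1)) = 1"
    using assms(2) by simp
  then have "P \<noteq> 0" by auto
  then have "card {x. poly P x = 0} \<le> degree P"
    by (rule card_poly_roots_bound)
  also have "degree P \<le> q ^ (m - 1)"
    unfolding P_def using assms
    by (intro degree_sum_le) (auto simp: degree_monom_eq intro!: power_increasing)
  also have "{x. poly P x = 0} = {x. field_trace q m x = 0}"
    by (simp add: P_def poly_sum poly_monom field_trace_def)
  finally show ?thesis .
qed

text \<open>
  The lower bound comes from \<open>q ^ m = card (range tr) * card (ker tr)\<close> together with
  \<open>card (range tr) \<le> q\<close>; the surjectivity of the trace onto the subfield is thus a consequence
  of the count.
\<close>
lemma card_kernel_trace:
  assumes "q = CHAR('a::finite_field) ^ k" "q > 1" "m > 0" "CARD('a) = q ^ m"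
  shows "card {x :: 'a. field_trace q m x = 0} = q ^ (m - 1)"
proof (rule antisym)
  let ?tr = "field_trace q m :: 'a \<Rightarrow> 'a" and ?K = "{x :: 'a. field_trace q m x = 0}"
  have fibre: "card {x. ?tr x = ?tr z} = card ?K" for z
  proof -
    have "?tr (x - z) + ?tr z = ?tr x" for x
      using field_trace_add[OF assms(1), of m "x - z" z] by simp
    then have "bij_betw (\<lambda>x. x - z) {x. ?tr x = ?tr z} ?K"
      by (intro bij_betw_byWitness[where f' = "\<lambda>x. x + z"])
        (auto simp: field_trace_add[OF assms(1)], (metis add_cancel_left_left)+)
    then show ?thesis by (rule bij_betw_same_card)
  qed
  have "q ^ m = (\<Sum>y\<in>range ?tr. card {x. ?tr x = y})"
    using sum.image_gen[of UNIV "\<lambda>_. 1::nat" ?tr] assms(4) by simp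
  also have "\<dots> = (\<Sum>y\<in>range ?tr. card ?K)"
    using fibre by (intro sum.cong) auto
  also have "\<dots> = card (range ?tr) * card ?K"
    by simp
  also have "card (range ?tr) \<le> card {y :: 'a. y ^ q = y}"
    using field_trace_power[OF assms(1,4)] by (intro card_mono) auto
  also have "\<dots> \<le> q"
    using assms(2) by (rule card_power_fixed_le)
  finally have "q * q ^ (m - 1) \<le> q * card ?K"
    using assms(3) by (simp add: power_eq_if)
  then show "q ^ (m - 1) \<le> card ?K"
    using assms(2) by simp
qed (use card_kernel_trace_le assms in blast)

lemma field_trace_scale:
  fixes c x :: "'a::finite_field"
  assumes "c ^ q = c"
  shows "field_trace q m (c * x) = c * field_trace q m x"
proof -
  have "c ^ (q ^ i) = c" for i
    by (induction i) (simp_all add: assms power_mult)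
  then show ?thesis
    by (simp add: field_trace_def power_mult_distrib sum_distrib_left)
qed

section \<open>Free elements of trace zero\<close>

theorem corollary1p4:
  fixes q m N :: nat
  assumes "primepow q"
    and "m > 0"
    and "CARD('a::finite_field) = q ^ m"
    and "N dvd q - 1"
    and "coprime N ((q ^ m - 1) div (q - 1))"
  shows "real (card {\<xi>::'a. N_free N \<xi> \<and> field_trace q m \<xi> = 0})
    = real (totient N) / real N * (real q ^ (m - 1) - 1)"
proof -
  have q: "q > 1"
    using primepow_gt_Suc_0[OF assms(1)] by simp
  obtain k where k: "q = CHAR('a) ^ k"
    using card_eq_power_imp_power_CHAR[OF assms(1-3)] .
  define K where "K = {x :: 'a. field_trace q m x = 0}"
  define T where "T = K - {0}"
  have zero: "0 \<in> K"
    using q by (simp add: K_def field_trace_def power_0_left)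
  have card_T: "real (card T) = real q ^ (m - 1) - 1"
    using card_kernel_trace[OF k q assms(2,3)] zero q
    by (simp add: T_def card_Diff_singleton of_nat_diff flip: K_def)
  have "[q = 1] (mod (q - 1))"
    using q by (simp add: cong_altdef_nat)
  then have "[q ^ m = 1] (mod (q - 1))"
    using cong_pow[of q 1 "q - 1" m] by simp
  then have "q - 1 dvd CARD('a) - 1"
    unfolding assms(3) by (rule cong_to_1_nat)
  then have "N * card {x \<in> T. N_free N x} = totient N * card T"
  proof (rule card_N_free_invariant)
    fix c x :: 'a assume c: "c ^ (q - 1) = 1" and x: "x \<in> T"
    have "c \<noteq> 0"
      using c q by (auto simp: power_0_left)
    moreover have "c ^ q = c"
      using c q by (simp add: power_eq_if)
    ultimately show "c * x \<in> T"
      using x by (simp add: T_def K_def field_trace_scale)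
  qed (use assms T_def in auto)
  moreover have "{x \<in> T. N_free N x} = {\<xi>. N_free N \<xi> \<and> field_trace q m \<xi> = 0}"
    by (auto simp: T_def K_def N_free_def)
  ultimately have "real N * real (card {\<xi>::'a. N_free N \<xi> \<and> field_trace q m \<xi> = 0})
      = real (totient N) * (real q ^ (m - 1) - 1)"
    by (metis card_T of_nat_mult)
  moreover have "N > 0"
    using assms(4) q by (auto intro: Nat.gr0I)
  ultimately show ?thesis
    by (simp add: field_simps)
qed

end
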